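(* Let $K$ be a field and $S=K[t_1,\dots,t_s]$. If $(0)\ne I\subset S$ is an unmixed graded ideal and $\dim(S/I)\ge1$, then $$\delta_I(d,H_I(d))=\deg(S/I)\quad\text{for all } d\ge1.$$
   Context: $S=\bigoplus_{d\ge0}S_d$ has the standard grading; $K$ is arbitrary. An ideal is unmixed if it is proper and all its associated primes have the same height. $H_I(d)=\dim_K(S_d/I_d)$. With $k=\dim(S/I)$, $\deg(S/I)=(k-1)!\lim_{d\to\infty}H_I(d)/d^{k-1}$ if $k\ge1$ and $\dim_K(S/I)$ if $k=0$. Generalized minimum distance function: for $d,r\ge 1$ let $\mathcal F_{d,r}$ be the set of all $F=\{f_1,\dots,f_r\}\subset S_d$ such that the classes $\overline f_1,\dots,\overline f_r$ in $S/I$ are linearly independent over $K$ and $(I:(f_1,\dots,f_r))\ne I$. Put $\delta_I(d,r)=\deg(S/I)-\max\{\deg(S/(I,F)) : F\in\mathcal F_{d,r}\}$ if $\mathcal F_{d,r}\neq\emptyset$, and $\delta_I(d,r)=\deg(S/I)$ if $\mathcal F_{d,r}=\emptyset$. *)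

theory Defs
  imports
    Complex_Main
    "HOL-Library.Poly_Mapping"
    "HOL-Library.Extended_Nat"
    "HOL-Algebra.Embedded_Algebras"
    "HOL-Algebra.QuotRing"
begin

section \<open>Notions for commutative rings\<close>

definition prime_chain :: "('a, 'b) ring_scheme \<Rightarrow> (nat \<Rightarrow> 'a set) \<Rightarrow> nat \<Rightarrow> bool" where
  "prime_chain R P n \<longleftrightarrow> (\<forall>i\<le>n. primeideal (P i) R) \<and> (\<forall>i<n. P i \<subset> P (Suc i))"

text \<open>Suprema are taken in \<^typ>\<open>enat\<close>; the zero ring, which has no primes, gets dimension 0.\<close>

definition krull_dim :: "('a, 'b) ring_scheme \<Rightarrow> enat" where
  "krull_dim R = Sup {enat n | n. \<exists>P. prime_chain R P n}"

definition prime_height :: "('a, 'b) ring_scheme \<Rightarrow> 'a set \<Rightarrow> enat" where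
  "prime_height R p = Sup {enat n | n. \<exists>P. prime_chain R P n \<and> P n = p}"

definition ideal_quotient :: "('a, 'b) ring_scheme \<Rightarrow> 'a set \<Rightarrow> 'a set \<Rightarrow> 'a set" where
  "ideal_quotient R I J = {x \<in> carrier R. \<forall>y\<in>J. x \<otimes>\<^bsub>R\<^esub> y \<in> I}"

text \<open>The associated primes of \<open>I\<close> are the primes that are annihilators of an element of \<open>R/I\<close>;
  the annihilator of the class of \<open>f\<close> is \<open>(I : f)\<close>.\<close>

definition associated_primes :: "('a, 'b) ring_scheme \<Rightarrow> 'a set \<Rightarrow> 'a set set" where
  "associated_primes R I =
     {p. primeideal p R \<and> (\<exists>f\<in>carrier R. p = ideal_quotient R I {f})}"

definition unmixed_ideal :: "('a, 'b) ring_scheme \<Rightarrow> 'a set \<Rightarrow> bool" where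
  "unmixed_ideal R I \<longleftrightarrow> ideal I R \<and> I \<noteq> carrier R \<and>
     (\<forall>p\<in>associated_primes R I. \<forall>q\<in>associated_primes R I. prime_height R p = prime_height R q)"


section \<open>The polynomial ring and its standard grading\<close>

text \<open>Polynomials over \<open>'k\<close> in the finitely many variables indexed by \<open>'n\<close>: finitely supported
  maps from exponent vectors to coefficients, with the convolution product of
  \<^theory>\<open>HOL-Library.Poly_Mapping\<close>.\<close>

type_synonym ('n, 'k) mpoly = "('n \<Rightarrow>\<^sub>0 nat) \<Rightarrow>\<^sub>0 'k"

definition poly_ring :: "('n::finite, 'k::field) mpoly ring" where
  "poly_ring = \<lparr>carrier = UNIV, mult = (*), one = 1, zero = 0, add = (+)\<rparr>"

lemma poly_ring_simps [simp]:
  "carrier poly_ring = UNIV" "x \<otimes>\<^bsub>poly_ring\<^esub> y = x * y" "\<one>\<^bsub>poly_ring\<^esub> = 1"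
  "\<zero>\<^bsub>poly_ring\<^esub> = 0" "x \<oplus>\<^bsub>poly_ring\<^esub> y = x + y"
  by (simp_all add: poly_ring_def)

lemma cring_poly_ring: "cring poly_ring"
proof (intro cringI abelian_groupI comm_monoidI)
  fix x :: "('n::finite, 'k::field) mpoly"
  show "\<exists>y\<in>carrier poly_ring. y \<oplus>\<^bsub>poly_ring\<^esub> x = \<zero>\<^bsub>poly_ring\<^esub>"
    by (rule bexI[of _ "- x"]) simp_all
qed (simp_all add: algebra_simps)

definition mdeg :: "('n::finite \<Rightarrow>\<^sub>0 nat) \<Rightarrow> nat" where
  "mdeg m = (\<Sum>i\<in>UNIV. Poly_Mapping.lookup m i)"

definition forms :: "nat \<Rightarrow> ('n::finite, 'k::field) mpoly set" where
  "forms d = {p. \<forall>m\<in>Poly_Mapping.keys p. mdeg m = d}"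

definition form_component :: "nat \<Rightarrow> ('n::finite, 'k::field) mpoly \<Rightarrow> ('n, 'k) mpoly" where
  "form_component d p =
     (\<Sum>m\<in>{m \<in> Poly_Mapping.keys p. mdeg m = d}. Poly_Mapping.single m (Poly_Mapping.lookup p m))"

text \<open>\<open>I\<close> is the direct sum of its homogeneous parts \<open>I \<inter> S\<^sub>d\<close>.\<close>

definition graded_ideal :: "('n::finite, 'k::field) mpoly set \<Rightarrow> bool" where
  "graded_ideal I \<longleftrightarrow> ideal I poly_ring \<and> (\<forall>p\<in>I. \<forall>d. form_component d p \<in> I)"


section \<open>Vector space structure on the quotient, Hilbert function and degree\<close>

abbreviation residue_class ::
    "('n::finite, 'k::field) mpoly set \<Rightarrow> ('n, 'k) mpoly \<Rightarrow> ('n, 'k) mpoly set" where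
  "residue_class I f \<equiv> I +>\<^bsub>poly_ring\<^esub> f"

definition quot_scalars :: "('n::finite, 'k::field) mpoly set \<Rightarrow> ('n, 'k) mpoly set set" where
  "quot_scalars I = residue_class I ` range (Poly_Mapping.single 0)"

text \<open>For \<open>I\<close> a proper ideal, this is a copy of the field of coefficients inside the quotient ring,
  so that linear independence and dimension over it are those over the coefficient field.\<close>

lemma quot_scalars_subfield:
  fixes I :: "('n::finite, 'k::field) mpoly set"
  assumes "ideal I poly_ring" "I \<noteq> UNIV"
  shows "subfield (quot_scalars I) (poly_ring Quot I)"
proof -
  let ?R = "poly_ring :: ('n, 'k) mpoly ring"
  let ?K = "range (Poly_Mapping.single 0) :: ('n, 'k) mpoly set"
  interpret R: cring ?R by (rule cring_poly_ring)
  have inv: "\<ominus>\<^bsub>?R\<^esub> h = - h" for h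
    by (rule R.minus_equality) simp_all
  have sub: "subring ?K ?R"
  proof (rule R.subringI)
    show "\<one>\<^bsub>?R\<^esub> \<in> ?K" by (metis poly_ring_simps(3) rangeI single_one)
    show "\<ominus>\<^bsub>?R\<^esub> h \<in> ?K" if "h \<in> ?K" for h
      using that by (auto simp: inv simp flip: single_uminus)
    show "g \<otimes>\<^bsub>?R\<^esub> h \<in> ?K" if "g \<in> ?K" "h \<in> ?K" for g h
      using that by (auto simp: mult_single)
    show "g \<oplus>\<^bsub>?R\<^esub> h \<in> ?K" if "g \<in> ?K" "h \<in> ?K" for g h
      using that by (auto simp flip: single_add)
  qed simp
  have "Units (?R \<lparr>carrier := ?K\<rparr>) = ?K - {\<zero>\<^bsub>?R\<^esub>}"
  proof (intro equalityI subsetI)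
    fix u assume "u \<in> Units (?R \<lparr>carrier := ?K\<rparr>)"
    then show "u \<in> ?K - {\<zero>\<^bsub>?R\<^esub>}" by (auto simp: Units_def)
  next
    fix u assume u: "u \<in> ?K - {\<zero>\<^bsub>?R\<^esub>}"
    then obtain c where c: "u = Poly_Mapping.single 0 c" by blast
    have "c \<noteq> 0" using u c by (metis DiffD2 singletonI single_zero poly_ring_simps(4))
    with c have "Poly_Mapping.single 0 (inverse c) * u = 1" "u * Poly_Mapping.single 0 (inverse c) = 1"
      by (simp_all add: mult_single)
    then have "\<exists>v\<in>?K. v * u = 1 \<and> u * v = 1" by blast
    then show "u \<in> Units (?R \<lparr>carrier := ?K\<rparr>)"
      using u by (simp add: Units_def)
  qed
  then have field: "subfield ?K ?R"
    by (rule R.subfieldI[OF R.subcringI'[OF sub]])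
  interpret I: ideal I ?R by fact
  interpret h: ring_hom_ring ?R "?R Quot I" "residue_class I" by (rule I.rcos_ring_hom_ring)
  have "\<one>\<^bsub>?R Quot I\<^esub> \<noteq> \<zero>\<^bsub>?R Quot I\<^esub>"
  proof
    assume "\<one>\<^bsub>?R Quot I\<^esub> = \<zero>\<^bsub>?R Quot I\<^esub>"
    then have "residue_class I \<one>\<^bsub>?R\<^esub> = I" by (simp add: FactRing_def)
    then have "\<one>\<^bsub>?R\<^esub> \<in> I" using I.rcos_const_imp_mem[OF R.one_closed] by blast
    then have "I = UNIV" using I.one_imp_carrier by simp
    with assms(2) show False by contradiction
  qed
  from h.img_is_subfield(2)[OF field this] show ?thesis by (simp only: quot_scalars_def)
qed

definition quot_dim :: "('n::finite, 'k::field) mpoly set \<Rightarrow> ('n, 'k) mpoly set set \<Rightarrow> nat" where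
  "quot_dim I E = (ring.dim (poly_ring Quot I) over quot_scalars I) E"

text \<open>\<open>S\<^sub>d/I\<^sub>d\<close> with \<open>I\<^sub>d = I \<inter> S\<^sub>d\<close> is realised as the image of \<open>S\<^sub>d\<close> in \<open>S/I\<close>.\<close>

definition hilbert_fun :: "('n::finite, 'k::field) mpoly set \<Rightarrow> nat \<Rightarrow> nat" where
  "hilbert_fun I d = quot_dim I (residue_class I ` forms d)"

definition quot_degree :: "('n::finite, 'k::field) mpoly set \<Rightarrow> real" where
  "quot_degree I =
     (let k = the_enat (krull_dim (poly_ring Quot I))
      in if k \<ge> 1 then fact (k - 1) * lim (\<lambda>d. real (hilbert_fun I d) / real d ^ (k - 1))
         else real (quot_dim I (carrier (poly_ring Quot I))))"


section \<open>The generalized minimum distance function\<close>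

definition gmd_family ::
    "('n::finite, 'k::field) mpoly set \<Rightarrow> nat \<Rightarrow> nat \<Rightarrow> ('n, 'k) mpoly set set" where
  "gmd_family I d r =
     {set fs | fs. length fs = r \<and> set fs \<subseteq> forms d \<and>
        ring.independent (poly_ring Quot I) (quot_scalars I) (map (residue_class I) fs) \<and>
        ideal_quotient poly_ring I (genideal poly_ring (set fs)) \<noteq> I}"

definition gmd :: "('n::finite, 'k::field) mpoly set \<Rightarrow> nat \<Rightarrow> nat \<Rightarrow> real" where
  "gmd I d r =
     (if gmd_family I d r \<noteq> {}
      then quot_degree I -
        Max ((\<lambda>F. quot_degree (genideal poly_ring (I \<union> F))) ` gmd_family I d r)
      else quot_degree I)"

end

theory Submission
  imports Defs
begin

text \<open>Any \<open>F\<close> in \<open>\<F>\<^bsub>d,r\<^esub>\<close> with \<open>r = H\<^sub>I(d)\<close> is a basis of \<open>S\<^sub>d/I\<^sub>d\<close>, so \<open>(I : (F)) \<noteq> I\<close> yields some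
  \<open>x \<notin> I\<close> with \<open>S\<^sub>d x \<subseteq> I\<close>, and the irrelevant ideal \<open>\<mm>\<close> becomes an associated prime of \<open>I\<close>.
  On the other hand, \<open>dim (S/I) \<ge> 1\<close> gives a prime \<open>P \<supseteq> I\<close> that is not maximal; its graded part is a
  prime between \<open>I\<close> and \<open>\<mm>\<close>, different from \<open>\<mm>\<close>, and contains an associated prime of \<open>I\<close> because
  \<open>S\<close> is Noetherian. As heights in \<open>S\<close> are finite, the two associated primes have different
  heights, which unmixedness forbids. Hence the family is empty.

  Noetherianity follows from Dickson's lemma applied to leading monomials. Heights are at most the
  number \<open>s\<close> of variables: from elements \<open>x\<^sub>i \<in> P\<^bsub>i+1\<^esub> - P\<^sub>i\<close> along a chain of length \<open>n\<close> one obtains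
  \<open>N\<^sup>n\<close> linearly independent monomials in the \<open>x\<^sub>i\<close>, while the polynomials of comparable degree
  form a space of dimension \<open>O(N\<^sup>s)\<close>.\<close>

section \<open>Ideals and prime ideals of the polynomial ring in elementwise form\<close>

lemma ideal_poly_ring_iff:
  "ideal J (poly_ring :: ('n::finite, 'k::field) mpoly ring) \<longleftrightarrow>
     0 \<in> J \<and> (\<forall>a\<in>J. \<forall>b\<in>J. a + b \<in> J) \<and> (\<forall>a\<in>J. \<forall>r. r * a \<in> J)"
  (is "ideal J ?R \<longleftrightarrow> ?rhs")
proof
  interpret R: cring ?R by (rule cring_poly_ring)
  show "ideal J ?R" if ?rhs
  proof (rule idealI)
    show "ring ?R" by (rule R.ring_axioms)
    show "subgroup J (add_monoid ?R)"
    proof (rule R.add.subgroupI)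
      show "\<ominus>\<^bsub>?R\<^esub> a \<in> J" if "a \<in> J" for a
      proof -
        have "\<ominus>\<^bsub>?R\<^esub> a = - a"
          by (rule R.minus_equality) simp_all
        also have "\<dots> = (- 1) * a" by simp
        finally show ?thesis using \<open>?rhs\<close> that by metis
      qed
    qed (use that in auto)
  qed (use that in \<open>auto simp: mult.commute\<close>)
next
  assume "ideal J ?R"
  then interpret ideal J ?R .
  show ?rhs
    using additive_subgroup.zero_closed[OF is_additive_subgroup]
      additive_subgroup.a_closed[OF is_additive_subgroup] I_l_closed by auto
qed

lemma
  fixes J :: "('n::finite, 'k::field) mpoly set"
  assumes "ideal J poly_ring"
  shows ideal_zero: "0 \<in> J"
    and ideal_add: "a \<in> J \<Longrightarrow> b \<in> J \<Longrightarrow> a + b \<in> J"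
    and ideal_mult: "a \<in> J \<Longrightarrow> r * a \<in> J"
    and ideal_mult': "a \<in> J \<Longrightarrow> a * r \<in> J"
  using assms by (auto simp: ideal_poly_ring_iff mult.commute)

lemma ideal_diff:
  fixes J :: "('n::finite, 'k::field) mpoly set"
  assumes "ideal J poly_ring" "a \<in> J" "b \<in> J"
  shows "a - b \<in> J"
  using ideal_add[OF assms(1,2) ideal_mult[OF assms(1,3), of "- 1"]] by simp

lemma ideal_sum:
  fixes J :: "('n::finite, 'k::field) mpoly set"
  assumes "ideal J poly_ring" "\<And>i. i \<in> A \<Longrightarrow> f i \<in> J"
  shows "sum f A \<in> J"
  using assms(2) by (induction A rule: infinite_finite_induct) (auto intro: ideal_add ideal_zero assms(1))

lemma primeideal_poly_ring_iff:
  "primeideal P (poly_ring :: ('n::finite, 'k::field) mpoly ring) \<longleftrightarrow>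
     ideal P poly_ring \<and> 1 \<notin> P \<and> (\<forall>a b. a * b \<in> P \<longrightarrow> a \<in> P \<or> b \<in> P)"
proof -
  have "ideal P poly_ring \<Longrightarrow> 1 \<in> P \<longleftrightarrow> P = UNIV"
    using ideal_mult[of P 1] by fastforce
  then show ?thesis
    by (auto simp: primeideal_def primeideal_axioms_def cring_poly_ring)
qed

lemma
  fixes P :: "('n::finite, 'k::field) mpoly set"
  assumes "primeideal P poly_ring"
  shows prime_ideal: "ideal P poly_ring"
    and prime_one: "1 \<notin> P"
    and prime_multD: "a * b \<in> P \<Longrightarrow> a \<in> P \<or> b \<in> P"
  using assms by (auto simp: primeideal_poly_ring_iff)

text \<open>Nonzero constants are units. With \<open>p = 1\<close> it follows that an ideal
  containing a nonzero constant contains 1.\<close>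

lemma single_unit_in_ideal:
  fixes J :: "('n::finite, 'k::field) mpoly set"
  assumes "ideal J poly_ring" "Poly_Mapping.single 0 c * p \<in> J" "c \<noteq> 0"
  shows "p \<in> J"
proof -
  have "Poly_Mapping.single 0 (inverse c) * (Poly_Mapping.single 0 c * p) = p"
    using assms(3) by (simp add: mult_single flip: mult.assoc)
  then show ?thesis
    using ideal_mult[OF assms(1,2)] by metis
qed

lemma ideal_quotient_singleton:
  fixes I :: "('n::finite, 'k::field) mpoly set"
  shows "ideal_quotient poly_ring I {x} = {y. y * x \<in> I}"
  by (simp add: ideal_quotient_def)

lemma ideal_ideal_quotient_singleton:
  fixes I :: "('n::finite, 'k::field) mpoly set"
  assumes "ideal I poly_ring"
  shows "ideal (ideal_quotient poly_ring I {x}) poly_ring"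
  unfolding ideal_quotient_singleton using assms
  by (auto simp: ideal_poly_ring_iff distrib_right mult.assoc)

lemma mpoly_eq_sum_single:
  fixes p :: "('n::finite, 'k::field) mpoly"
  assumes "finite A" "Poly_Mapping.keys p \<subseteq> A"
  shows "p = (\<Sum>m\<in>A. Poly_Mapping.single m (Poly_Mapping.lookup p m))"
proof (rule poly_mapping_eqI)
  fix k
  have "(\<Sum>m\<in>A. Poly_Mapping.lookup (Poly_Mapping.single m (Poly_Mapping.lookup p m)) k)
      = (\<Sum>m\<in>A. if m = k then Poly_Mapping.lookup p k else 0)"
    by (intro sum.cong) (auto simp: lookup_single)
  also have "\<dots> = Poly_Mapping.lookup p k"
    using assms by (auto simp: in_keys_iff)
  finally show "Poly_Mapping.lookup p k
      = Poly_Mapping.lookup (\<Sum>m\<in>A. Poly_Mapping.single m (Poly_Mapping.lookup p m)) k"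
    by (simp add: lookup_sum)
qed

section \<open>Noetherianity\<close>

text \<open>Every sequence has a monotone subsequence, and a nonincreasing one in the naturals is
  constant from the index of its minimum on.\<close>

lemma nat_seq_mono_subseq:
  fixes f :: "nat \<Rightarrow> nat"
  shows "\<exists>r :: nat \<Rightarrow> nat. strict_mono r \<and> mono (f \<circ> r)"
proof -
  obtain r where r: "strict_mono r" "monoseq (f \<circ> r)"
    using seq_monosub[of f] by (auto simp: comp_def)
  show ?thesis
  proof (cases "mono (f \<circ> r)")
    case False
    with r(2) have dec: "\<And>i j. i \<le> j \<Longrightarrow> f (r j) \<le> f (r i)"
      by (auto simp: monoseq_def mono_def)
    define N where "N = arg_min (f \<circ> r) (\<lambda>_. True)"
    have "f (r N) \<le> f (r i)" for i
      using arg_min_nat_le[of "\<lambda>_. True" i "f \<circ> r"] by (simp add: N_def)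
    then have "f (r (N + i)) = f (r N)" for i
      using dec[of N "N + i"] by (simp add: le_antisym)
    then have "mono (f \<circ> (\<lambda>i. r (N + i)))" by (simp add: mono_def)
    moreover have "strict_mono (\<lambda>i. r (N + i))"
      using r(1) by (simp add: strict_mono_def)
    ultimately show ?thesis by (intro exI[of _ "\<lambda>i. r (N + i)"] conjI)
  qed (use r in blast)
qed

text \<open>Thin out one coordinate at a time: monotonicity already reached survives passing to a
  further subsequence.\<close>

lemma mono_subseq_simultaneous:
  fixes f :: "nat \<Rightarrow> 'i \<Rightarrow> nat"
  assumes "finite V"
  shows "\<exists>r :: nat \<Rightarrow> nat. strict_mono r \<and> (\<forall>x\<in>V. mono (\<lambda>i. f (r i) x))"
  using assms
proof (induction V)
  case empty
  then show ?case using strict_mono_id by blast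
next
  case (insert y V)
  then obtain r :: "nat \<Rightarrow> nat" where r: "strict_mono r" "\<forall>x\<in>V. mono (\<lambda>i. f (r i) x)" by blast
  obtain q :: "nat \<Rightarrow> nat" where q: "strict_mono q" "mono ((\<lambda>i. f (r i) y) \<circ> q)"
    using nat_seq_mono_subseq[of "\<lambda>i. f (r i) y"] by blast
  have "strict_mono (r \<circ> q)" using r q by (simp add: strict_mono_o)
  moreover have "mono (\<lambda>i. f ((r \<circ> q) i) x)" if "x \<in> insert y V" for x
    using that r(2) q strict_mono_mono[OF q(1)] by (auto simp: mono_def)
  ultimately show ?case by blast
qed

lemma dickson:
  fixes f :: "nat \<Rightarrow> ('n::finite \<Rightarrow> nat)"
  shows "\<exists>i j. i < j \<and> (\<forall>x. f i x \<le> f j x)"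
proof -
  obtain r :: "nat \<Rightarrow> nat" where r: "strict_mono r" "\<forall>x. mono (\<lambda>i. f (r i) x)"
    using mono_subseq_simultaneous[of UNIV f] by auto
  then have "r 0 < r 1" "f (r 0) x \<le> f (r 1) x" for x
    by (auto simp: strict_mono_def mono_def)
  then show ?thesis by blast
qed

text \<open>The lexicographic monomial order for the sequence \<open>xs\<close> of variables.
  \<open>lex\<close> compares lists of equal length only, which makes the order well-founded; it is
  total once \<open>xs\<close> lists all variables.\<close>

definition mon_less :: "'n list \<Rightarrow> (('n \<Rightarrow>\<^sub>0 nat) \<times> ('n \<Rightarrow>\<^sub>0 nat)) set" where
  "mon_less xs = inv_image (lex less_than) (\<lambda>m. map (Poly_Mapping.lookup m) xs)"

lemma mon_less_Nil [simp]: "(a, b) \<notin> mon_less []"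
  by (simp add: mon_less_def)

lemma mon_less_Cons [simp]:
  "(a, b) \<in> mon_less (x # xs) \<longleftrightarrow> Poly_Mapping.lookup a x < Poly_Mapping.lookup b x \<or>
     Poly_Mapping.lookup a x = Poly_Mapping.lookup b x \<and> (a, b) \<in> mon_less xs"
  by (simp add: mon_less_def)

lemma wf_mon_less: "wf (mon_less xs)"
  by (auto simp: mon_less_def)

lemma mon_less_total:
  "(a, b) \<in> mon_less xs \<or> (b, a) \<in> mon_less xs \<or>
     (\<forall>x\<in>set xs. Poly_Mapping.lookup a x = Poly_Mapping.lookup b x)"
  by (induction xs) auto

lemma mon_less_trans: "(a, b) \<in> mon_less xs \<Longrightarrow> (b, c) \<in> mon_less xs \<Longrightarrow> (a, c) \<in> mon_less xs"
  by (induction xs) auto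

lemma mon_less_add: "(a, b) \<in> mon_less xs \<Longrightarrow> (c + a, c + b) \<in> mon_less xs"
  by (induction xs) (auto simp: lookup_add)

text \<open>A relation rather than a function, because the zero polynomial has no leading
  monomial.\<close>

definition leading :: "'n list \<Rightarrow> ('n::finite, 'k::field) mpoly \<Rightarrow> ('n \<Rightarrow>\<^sub>0 nat) \<Rightarrow> bool" where
  "leading xs p a \<longleftrightarrow>
     a \<in> Poly_Mapping.keys p \<and> (\<forall>b\<in>Poly_Mapping.keys p. b \<noteq> a \<longrightarrow> (b, a) \<in> mon_less xs)"

lemma leading_exists:
  fixes p :: "('n::finite, 'k::field) mpoly"
  assumes "set xs = UNIV" "p \<noteq> 0"
  shows "\<exists>a. leading xs p a"
proof -
  have "\<exists>a\<in>K. \<forall>b\<in>K. b \<noteq> a \<longrightarrow> (b, a) \<in> mon_less xs"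
    if "finite K" "K \<noteq> {}" for K :: "('n \<Rightarrow>\<^sub>0 nat) set"
    using that
  proof (induction K rule: finite_ne_induct)
    case (insert c K)
    then obtain a where a: "a \<in> K" "\<forall>b\<in>K. b \<noteq> a \<longrightarrow> (b, a) \<in> mon_less xs" by blast
    have "c \<noteq> a" using a(1) insert.hyps by auto
    \<comment> \<open>Since \<open>xs\<close> contains every variable, only equal exponent vectors
      are incomparable.\<close>
    moreover have "a = c" if "\<forall>x\<in>set xs. Poly_Mapping.lookup a x = Poly_Mapping.lookup c x"
      using that assms(1) by (intro poly_mapping_eqI) simp
    ultimately have "(a, c) \<in> mon_less xs \<or> (c, a) \<in> mon_less xs"
      using mon_less_total[of a c xs] by blast
    then show ?case
    proof
      assume ac: "(a, c) \<in> mon_less xs"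
      with a(2) have "\<forall>b\<in>K. (b, c) \<in> mon_less xs" using mon_less_trans by metis
      then show ?thesis by auto
    next
      assume "(c, a) \<in> mon_less xs"
      with a show ?thesis by auto
    qed
  qed simp
  from this[of "Poly_Mapping.keys p"] show ?thesis
    using assms(2) by (auto simp: leading_def)
qed

text \<open>One step of polynomial division: \<open>h\<close> is a monomial with coefficient chosen
  such that \<open>h * f\<close> and \<open>g\<close> have the same leading term, so it cancels in
  the difference and only smaller monomials remain.\<close>

lemma leading_cancel:
  fixes f g :: "('n::finite, 'k::field) mpoly"
  assumes xs: "set xs = UNIV" and f: "leading xs f a" and g: "leading xs g b"
    and le: "\<And>i. Poly_Mapping.lookup a i \<le> Poly_Mapping.lookup b i"
  obtains h where "\<And>c. leading xs (g - h * f) c \<Longrightarrow> (c, b) \<in> mon_less xs"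
proof
  define u where "u = b - a"
  define k where "k = Poly_Mapping.lookup g b / Poly_Mapping.lookup f a"
  let ?h = "Poly_Mapping.single u k"
  have ba: "u + a = b"
    using le by (intro poly_mapping_eqI) (simp add: u_def lookup_add lookup_minus)
  have fa: "Poly_Mapping.lookup f a \<noteq> 0" using f by (simp add: leading_def in_keys_iff)
  have below: "m = b \<or> (m, b) \<in> mon_less xs" if "m \<in> Poly_Mapping.keys (?h * f)" for m
  proof -
    from that obtain m' where "m' \<in> Poly_Mapping.keys f" "m = u + m'"
      using keys_mult[of ?h f] by (auto split: if_splits)
    then show ?thesis using f mon_less_add[of m' a xs u] ba by (auto simp: leading_def)
  qed
  \<comment> \<open>Split off the leading term of \<open>f\<close>: no other term can contribute to
    the coefficient at \<open>b\<close>, because adding \<open>u\<close> to exponent vectors is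
    injective.\<close>
  have "?h * f = ?h * (Poly_Mapping.single a (Poly_Mapping.lookup f a))
      + ?h * (f - Poly_Mapping.single a (Poly_Mapping.lookup f a))"
    by (simp add: algebra_simps)
  moreover have "b \<notin> Poly_Mapping.keys (?h * (f - Poly_Mapping.single a (Poly_Mapping.lookup f a)))"
  proof
    assume "b \<in> Poly_Mapping.keys (?h * (f - Poly_Mapping.single a (Poly_Mapping.lookup f a)))"
    then obtain m' where m': "m' \<in> Poly_Mapping.keys (f - Poly_Mapping.single a (Poly_Mapping.lookup f a))"
        "b = u + m'"
      using keys_mult[of ?h] by (fastforce split: if_splits)
    with ba have "m' = a" by (metis add_left_cancel)
    with m' show False by (simp add: in_keys_iff lookup_minus)
  qed
  ultimately have "Poly_Mapping.lookup (?h * f) b = Poly_Mapping.lookup g b"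
    using ba fa by (simp add: lookup_add mult_single in_keys_iff k_def)
  then have "b \<notin> Poly_Mapping.keys (g - ?h * f)"
    by (simp add: in_keys_iff lookup_minus)
  show "(c, b) \<in> mon_less xs" if "leading xs (g - ?h * f) c" for c
  proof -
    from that have c: "c \<in> Poly_Mapping.keys (g - ?h * f)" by (simp add: leading_def)
    then have "c \<noteq> b" using \<open>b \<notin> Poly_Mapping.keys (g - ?h * f)\<close> by blast
    moreover have "c \<in> Poly_Mapping.keys g \<or> c \<in> Poly_Mapping.keys (?h * f)"
      using c by (auto simp: in_keys_iff lookup_minus)
    ultimately show ?thesis using g below by (auto simp: leading_def)
  qed
qed

text \<open>From each layer \<open>J (Suc i) - J i\<close> take an element whose leading monomial is
  minimal. By Dickson's lemma one of these monomials divides a later one, and cancelling produces an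
  element of the later layer with a smaller leading monomial.\<close>

lemma no_ideal_chain:
  fixes J :: "nat \<Rightarrow> ('n::finite, 'k::field) mpoly set"
  assumes J: "\<And>i. ideal (J i) poly_ring"
  shows "\<not> (\<forall>i. J i \<subset> J (Suc i))"
proof
  assume strict: "\<forall>i. J i \<subset> J (Suc i)"
  then have "mono J" by (simp add: mono_iff_le_Suc less_imp_le)
  obtain xs :: "'n list" where xs: "set xs = UNIV" using finite_list[OF finite_UNIV] by blast
  have "\<exists>a f. f \<in> J (Suc i) - J i \<and> leading xs f a \<and>
      (\<forall>b g. g \<in> J (Suc i) - J i \<longrightarrow> leading xs g b \<longrightarrow> (b, a) \<notin> mon_less xs)" for i
  proof -
    let ?A = "{a. \<exists>f \<in> J (Suc i) - J i. leading xs f a}"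
    obtain f where f: "f \<in> J (Suc i) - J i" using strict by blast
    then have "f \<noteq> 0" using ideal_zero[OF J] by blast
    with f leading_exists[OF xs] obtain a where "a \<in> ?A" by blast
    then obtain z where "z \<in> ?A" "\<And>y. (y, z) \<in> mon_less xs \<Longrightarrow> y \<notin> ?A"
      using wfE_min[OF wf_mon_less, of a ?A xs] by blast
    then show ?thesis by blast
  qed
  then obtain a f where af: "\<And>i. f i \<in> J (Suc i) - J i" "\<And>i. leading xs (f i) (a i)"
      "\<And>i b g. g \<in> J (Suc i) - J i \<Longrightarrow> leading xs g b \<Longrightarrow> (b, a i) \<notin> mon_less xs"
    by metis
  obtain i j where ij: "i < j" "\<And>x. Poly_Mapping.lookup (a i) x \<le> Poly_Mapping.lookup (a j) x"
    using dickson[of "\<lambda>i. Poly_Mapping.lookup (a i)"] by blast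
  obtain h where h: "\<And>c. leading xs (f j - h * f i) c \<Longrightarrow> (c, a j) \<in> mon_less xs"
    using leading_cancel[OF xs af(2)[of i] af(2)[of j] ij(2)] by blast
  have "f i \<in> J j" using monoD[OF \<open>mono J\<close>, of "Suc i" j] ij(1) af(1)[of i] by auto
  then have hf: "h * f i \<in> J j" using ideal_mult[OF J] by blast
  then have "h * f i \<in> J (Suc j)" using strict by blast
  then have "f j - h * f i \<in> J (Suc j)" using ideal_diff[OF J] af(1)[of j] by blast
  \<comment> \<open>Subtracting an element of \<open>J j\<close> does not leave the layer of
    \<open>f j\<close>, in which its leading monomial was minimal.\<close>
  moreover have "f j - h * f i \<notin> J j"
    using ideal_add[OF J _ hf, of "f j - h * f i"] af(1)[of j] by auto
  ultimately have mem: "f j - h * f i \<in> J (Suc j) - J j" by blast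
  then have "f j - h * f i \<noteq> 0" using ideal_zero[OF J] by auto
  then obtain c where "leading xs (f j - h * f i) c" using leading_exists[OF xs] by blast
  with h af(3)[OF mem] show False by blast
qed

text \<open>If every member had a strictly larger one, dependent choice would build an infinite
  ascending chain.\<close>

lemma ideal_family_maximal:
  fixes F :: "('n::finite, 'k::field) mpoly set set"
  assumes "F \<noteq> {}" "\<And>J. J \<in> F \<Longrightarrow> ideal J poly_ring"
  shows "\<exists>M\<in>F. \<forall>J\<in>F. \<not> M \<subset> J"
proof (rule ccontr)
  assume "\<not> ?thesis"
  then have step: "\<forall>M\<in>F. \<exists>J. J \<in> F \<and> M \<subset> J" by blast
  obtain J0 where "J0 \<in> F" using assms(1) by blast
  then obtain J where "\<And>i. J i \<in> F \<and> J i \<subset> J (Suc i)"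
    using dependent_nat_choice[of "\<lambda>_ M. M \<in> F" "\<lambda>_ M N. M \<subset> N"] step by metis
  then show False using no_ideal_chain[of J] assms(2) by blast
qed

text \<open>A maximal element among the ideals \<open>(I : x)\<close> contained in \<open>P\<close> is prime: passing from \<open>x\<close>
  to a multiple \<open>x z\<close> with \<open>z \<notin> P\<close> cannot enlarge it.\<close>

lemma associated_prime_below:
  fixes I :: "('n::finite, 'k::field) mpoly set"
  assumes I: "ideal I poly_ring" and P: "primeideal P poly_ring" and "I \<subseteq> P"
  shows "\<exists>q\<in>associated_primes poly_ring I. q \<subseteq> P"
proof -
  let ?Q = "\<lambda>x. ideal_quotient poly_ring I {x}"
  let ?F = "{?Q x | x. ?Q x \<subseteq> P}"
  \<comment> \<open>\<open>(I : 1) = I\<close> shows that the family is nonempty.\<close>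
  have "?Q 1 \<subseteq> P" using assms(3) by (auto simp: ideal_quotient_singleton)
  then have "?F \<noteq> {}" by blast
  moreover have "ideal J poly_ring" if "J \<in> ?F" for J
    using that ideal_ideal_quotient_singleton[OF I] by auto
  ultimately have "\<exists>M\<in>?F. \<forall>J\<in>?F. \<not> M \<subset> J" by (rule ideal_family_maximal)
  then obtain M where M: "M \<in> ?F" "\<forall>J\<in>?F. \<not> M \<subset> J" by (rule bexE)
  from M(1) obtain x where x: "M = ?Q x" "?Q x \<subseteq> P" by blast
  have max: "\<not> ?Q x \<subset> ?Q y" if "?Q y \<subseteq> P" for y
    using M(2) that unfolding x(1) by blast
  have eq: "?Q (x * z) = ?Q x" if "?Q (x * z) \<subseteq> P" for z
  proof -
    have "y * (x * z) \<in> I" if "y * x \<in> I" for y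
      using ideal_mult'[OF I that, of z] by (simp add: mult.assoc)
    then have "?Q x \<subseteq> ?Q (x * z)" by (auto simp: ideal_quotient_singleton)
    with max[OF that] show ?thesis by blast
  qed
  have "primeideal (?Q x) poly_ring"
    unfolding primeideal_poly_ring_iff
  proof (intro conjI allI impI)
    show "ideal (?Q x) poly_ring" by (rule ideal_ideal_quotient_singleton[OF I])
    show "1 \<notin> ?Q x" using x prime_one[OF P] by blast
    show "b \<in> ?Q x \<or> c \<in> ?Q x" if bc: "b * c \<in> ?Q x" for b c
    proof (cases "?Q (x * c) \<subseteq> P")
      case True
      from bc have "b \<in> ?Q (x * c)"
        by (simp add: ideal_quotient_singleton algebra_simps)
      with eq[OF True] show ?thesis by simp
    next
      \<comment> \<open>Some \<open>z\<close> outside \<open>P\<close> satisfies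
        \<open>z * (x * c) \<in> I\<close>. Then \<open>c\<close> lies in \<open>(I : x z)\<close>,
        which equals \<open>(I : x)\<close> by maximality.\<close>
      case False
      then obtain z where z: "z \<notin> P" "z * (x * c) \<in> I"
        by (auto simp: ideal_quotient_singleton)
      have "?Q (x * z) \<subseteq> P"
      proof
        fix y assume "y \<in> ?Q (x * z)"
        then have "y * z \<in> ?Q x" by (simp add: ideal_quotient_singleton algebra_simps)
        with x z(1) show "y \<in> P" using prime_multD[OF P, of y z] by blast
      qed
      moreover have "c \<in> ?Q (x * z)" using z(2)
        by (simp add: ideal_quotient_singleton algebra_simps)
      ultimately show ?thesis using eq by blast
    qed
  qed
  with x show ?thesis by (auto simp: associated_primes_def)
qed

section \<open>Heights are finite\<close>

text \<open>Each exponent is bounded separately, not the total degree, so that the monomials allowed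
  form a cube with \<open>(D + 1) ^ s\<close> points.\<close>

definition exps_le :: "nat \<Rightarrow> ('n::finite, 'k::field) mpoly set" where
  "exps_le D = {p. \<forall>m\<in>Poly_Mapping.keys p. \<forall>i. Poly_Mapping.lookup m i \<le> D}"

lemma exps_le_mono: "D \<le> E \<Longrightarrow> p \<in> exps_le D \<Longrightarrow> p \<in> exps_le E"
  unfolding exps_le_def using order_trans by blast

lemma exps_le_one: "1 \<in> exps_le D"
  by (simp add: exps_le_def)

lemma exps_le_mult:
  assumes "p \<in> exps_le D" "q \<in> exps_le E"
  shows "p * q \<in> exps_le (D + E)"
  using assms keys_mult[of p q] by (fastforce simp: exps_le_def lookup_add intro: add_mono)

lemma exps_le_power: "p \<in> exps_le D \<Longrightarrow> p ^ j \<in> exps_le (j * D)"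
  by (induction j) (auto simp: exps_le_one exps_le_mult)

lemma finite_subset_exps_le:
  fixes F :: "('n::finite, 'k::field) mpoly set"
  assumes "finite F"
  shows "\<exists>e. F \<subseteq> exps_le e"
proof -
  let ?E = "\<Union>p\<in>F. \<Union>m\<in>Poly_Mapping.keys p. range (Poly_Mapping.lookup m)"
  have "finite ?E" using assms by auto
  \<comment> \<open>If \<open>?E\<close> is empty, \<open>Max\<close> is unspecified, but then no
    member of \<open>F\<close> has a monomial to be bounded.\<close>
  then have "F \<subseteq> exps_le (Max ?E)"
    by (auto simp: exps_le_def intro!: Max_ge)
  then show ?thesis by blast
qed

lemma card_bounded_exponents:
  "finite {m :: 'n::finite \<Rightarrow>\<^sub>0 nat. \<forall>i. Poly_Mapping.lookup m i \<le> D} \<and>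
   card {m :: 'n::finite \<Rightarrow>\<^sub>0 nat. \<forall>i. Poly_Mapping.lookup m i \<le> D} \<le> Suc D ^ card (UNIV :: 'n set)"
  (is "finite ?M \<and> card ?M \<le> _")
proof -
  let ?X = "PiE (UNIV :: 'n set) (\<lambda>_. {..D})"
  have inj: "inj_on Poly_Mapping.lookup ?M" by (auto intro: inj_onI poly_mapping_eqI)
  have sub: "Poly_Mapping.lookup ` ?M \<subseteq> ?X" by auto
  have fin: "finite ?X" by (intro finite_PiE) auto
  have "card ?X = Suc D ^ card (UNIV :: 'n set)" by (subst card_PiE) auto
  then show ?thesis
    using inj_on_finite[OF inj sub fin] card_inj_on_le[OF inj sub fin] by simp
qed

text \<open>Independence of the residue classes modulo \<open>P\<close> over the coefficient field,
  stated on representatives to avoid the quotient ring. It concerns a family, so a repeated value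
  counts as a dependence.\<close>

definition lin_indep_mod ::
    "('n::finite, 'k::field) mpoly set \<Rightarrow> ('i \<Rightarrow> ('n, 'k) mpoly) \<Rightarrow> 'i set \<Rightarrow> bool" where
  "lin_indep_mod P u A \<longleftrightarrow>
     (\<forall>c. (\<Sum>a\<in>A. Poly_Mapping.single 0 (c a) * u a) \<in> P \<longrightarrow> (\<forall>a\<in>A. c a = 0))"

lemma lin_indep_mod_inj:
  fixes u :: "'i \<Rightarrow> ('n::finite, 'k::field) mpoly"
  assumes "ideal P poly_ring" "finite A" "lin_indep_mod P u A"
  shows "inj_on u A"
proof (rule inj_onI, rule ccontr)
  fix a b assume ab: "a \<in> A" "b \<in> A" "u a = u b" "a \<noteq> b"
  define c where "c x = (if x = a then 1 else if x = b then - 1 else 0 :: 'k)" for x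
  have "(\<Sum>x\<in>A. Poly_Mapping.single 0 (c x) * u x) = (\<Sum>x\<in>{a, b}. Poly_Mapping.single 0 (c x) * u x)"
    using ab assms(2) by (intro sum.mono_neutral_right) (auto simp: c_def)
  also have "\<dots> = 0"
    using ab by (simp add: c_def single_uminus)
  finally have "c a = 0"
    using assms(3) ab(1) ideal_zero[OF assms(1)] by (auto simp: lin_indep_mod_def)
  then show False by (simp add: c_def)
qed

lemma lin_indep_mod_image:
  fixes u :: "'i \<Rightarrow> ('n::finite, 'k::field) mpoly"
  assumes "ideal P poly_ring" "finite A" "lin_indep_mod P u A"
  shows "lin_indep_mod P (\<lambda>x. x) (u ` A)"
  unfolding lin_indep_mod_def
proof (intro allI impI)
  fix c assume "(\<Sum>x\<in>u ` A. Poly_Mapping.single 0 (c x) * x) \<in> P"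
  then have "(\<Sum>a\<in>A. Poly_Mapping.single 0 ((c \<circ> u) a) * u a) \<in> P"
    by (simp add: sum.reindex[OF lin_indep_mod_inj[OF assms]])
  then have "\<forall>a\<in>A. (c \<circ> u) a = 0"
    using assms(3) unfolding lin_indep_mod_def by blast
  then show "\<forall>x\<in>u ` A. c x = 0" by simp
qed

text \<open>Independence modulo \<open>P\<close> implies independence in the polynomial ring because
  \<open>0 \<in> P\<close>, and \<open>exps_le D\<close> is spanned by at most
  \<open>(D + 1) ^ s\<close> monomials.\<close>

lemma card_lin_indep_mod_le:
  fixes U :: "('n::finite, 'k::field) mpoly set"
  assumes P: "ideal P poly_ring" and U: "finite U" "U \<subseteq> exps_le D" "lin_indep_mod P (\<lambda>x. x) U"
  shows "card U \<le> Suc D ^ card (UNIV :: 'n set)"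
proof -
  interpret vector_space "\<lambda>(c::'k) (p::('n, 'k) mpoly). Poly_Mapping.single 0 c * p"
    by unfold_locales (simp_all add: algebra_simps single_add mult_single flip: mult.assoc)
  let ?M = "{m :: 'n \<Rightarrow>\<^sub>0 nat. \<forall>i. Poly_Mapping.lookup m i \<le> D}"
  let ?T = "(\<lambda>m. Poly_Mapping.single m (1::'k)) ` ?M"
  have "independent U"
    using U(1,3) ideal_zero[OF P]
    by (intro independent_if_scalars_zero) (auto simp: lin_indep_mod_def)
  moreover have "U \<subseteq> span ?T"
  proof
    fix p assume "p \<in> U"
    with U(2) have keys: "Poly_Mapping.keys p \<subseteq> ?M" by (auto simp: exps_le_def)
    have "p = (\<Sum>m\<in>Poly_Mapping.keys p. Poly_Mapping.single m (Poly_Mapping.lookup p m))"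
      by (intro mpoly_eq_sum_single) auto
    also have "\<dots> = (\<Sum>m\<in>Poly_Mapping.keys p.
        Poly_Mapping.single 0 (Poly_Mapping.lookup p m) * Poly_Mapping.single m 1)"
      by (simp add: mult_single)
    also have "\<dots> \<in> span ?T"
      using keys by (intro span_sum span_scale span_base) auto
    finally show "p \<in> span ?T" .
  qed
  moreover have "finite ?T" "card ?T \<le> Suc D ^ card (UNIV :: 'n set)"
    using card_bounded_exponents[where ?'n = 'n, of D] card_image_le[of ?M "\<lambda>m. Poly_Mapping.single m (1::'k)"]
    by auto
  ultimately show ?thesis
    using independent_span_bound[of ?T U] by linarith
qed

text \<open>As \<open>x \<in> Q\<close>, the sum is congruent to \<open>G 0\<close> modulo
  \<open>Q\<close>, so \<open>G 0 = 0\<close>. What remains is divisible by \<open>x\<close>, which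
  can be cancelled because \<open>P\<close> is prime and \<open>x \<notin> P\<close>; then
  induct.\<close>

lemma prime_power_sum_zero:
  fixes G :: "nat \<Rightarrow> ('n::finite, 'k::field) mpoly"
  assumes P: "primeideal P poly_ring" and Q: "ideal Q poly_ring" and PQ: "P \<subseteq> Q"
    and x: "x \<in> Q" "x \<notin> P"
    and "\<And>j. j < N \<Longrightarrow> G j \<in> Q \<Longrightarrow> G j = 0"
    and "(\<Sum>j<N. x ^ j * G j) \<in> P"
  shows "j < N \<Longrightarrow> G j = 0"
  using assms(6,7)
proof (induction N arbitrary: G j)
  case (Suc N)
  let ?S = "\<Sum>j<N. x ^ j * G (Suc j)"
  have sum: "(\<Sum>j<Suc N. x ^ j * G j) = G 0 + x * ?S"
    by (simp only: sum.lessThan_Suc_shift power_Suc power_0 mult_1 sum_distrib_left mult.assoc)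
  have "G 0 + x * ?S \<in> Q" using Suc.prems(3) PQ sum by auto
  then have "G 0 \<in> Q"
    using ideal_diff[OF Q _ ideal_mult'[OF Q x(1), of ?S]] by fastforce
  then have G0: "G 0 = 0" using Suc.prems(2) by blast
  with Suc.prems(3) sum have "?S \<in> P"
    using prime_multD[OF P, of x ?S] x(2) by auto
  then have "G (Suc i) = 0" if "i < N" for i
    using Suc.IH[of i "\<lambda>j. G (Suc j)"] Suc.prems(2) that by auto
  then show ?case
    using G0 Suc.prems(1) by (cases j) auto
qed simp

text \<open>Group a relation by powers of \<open>x\<close>. Each coefficient \<open>?G j\<close> is
  a combination of the \<open>u a\<close>, hence lies in \<open>Q\<close> only if it is trivial,
  which is what \<open>prime_power_sum_zero\<close> asks for.\<close>

lemma lin_indep_mod_step: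
  fixes u :: "'i \<Rightarrow> ('n::finite, 'k::field) mpoly"
  assumes P: "primeideal P poly_ring" and Q: "ideal Q poly_ring" and PQ: "P \<subseteq> Q"
    and x: "x \<in> Q" "x \<notin> P"
    and A: "finite A" "lin_indep_mod Q u A"
  shows "lin_indep_mod P (\<lambda>(j, a). x ^ j * u a) ({..<N} \<times> A)"
  unfolding lin_indep_mod_def
proof (intro allI impI)
  fix c :: "nat \<times> 'i \<Rightarrow> 'k"
  let ?G = "\<lambda>j. \<Sum>a\<in>A. Poly_Mapping.single 0 (c (j, a)) * u a"
  assume "(\<Sum>p\<in>{..<N} \<times> A. Poly_Mapping.single 0 (c p) * (case p of (j, a) \<Rightarrow> x ^ j * u a)) \<in> P"
  also have "(\<Sum>p\<in>{..<N} \<times> A. Poly_Mapping.single 0 (c p) * (case p of (j, a) \<Rightarrow> x ^ j * u a))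
      = (\<Sum>p\<in>{..<N} \<times> A. case p of (j, a) \<Rightarrow> x ^ j * (Poly_Mapping.single 0 (c (j, a)) * u a))"
    by (intro sum.cong refl) (auto simp: mult.left_commute)
  also have "\<dots> = (\<Sum>j<N. x ^ j * ?G j)"
    by (simp add: sum.cartesian_product sum_distrib_left)
  finally have mem: "(\<Sum>j<N. x ^ j * ?G j) \<in> P" .
  have zero: "c (j, a) = 0" if "?G j \<in> Q" "a \<in> A" for j a
    using A(2)[unfolded lin_indep_mod_def, rule_format, of "\<lambda>a. c (j, a)"] that by simp
  then have "?G j \<in> Q \<Longrightarrow> ?G j = 0" for j
    by (intro sum.neutral) auto
  from prime_power_sum_zero[OF P Q PQ x this mem] have "?G j = 0" if "j < N" for j
    using that by blast
  then have "?G j \<in> Q" if "j < N" for j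
    using that ideal_zero[OF Q] by metis
  then show "\<forall>p\<in>{..<N} \<times> A. c p = 0"
    using zero by blast
qed

text \<open>Descend the chain from its top. Each step multiplies the independent set found so far by
  the powers \<open>x i ^ j\<close> with \<open>j < N\<close>, which multiplies its size by
  \<open>N\<close> and raises the exponents by at most \<open>N * e\<close>.\<close>

lemma prime_chain_indep:
  fixes P :: "nat \<Rightarrow> ('n::finite, 'k::field) mpoly set"
  assumes chain: "prime_chain poly_ring P n"
    and x: "\<And>i. i < n \<Longrightarrow> x i \<in> P (Suc i) - P i" "\<And>i. i < n \<Longrightarrow> x i \<in> exps_le e"
    and "k \<le> n"
  shows "\<exists>U. finite U \<and> card U = N ^ k \<and> U \<subseteq> exps_le (k * (N * e)) \<and>
    lin_indep_mod (P (n - k)) (\<lambda>u. u) U"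
  using \<open>k \<le> n\<close>
proof (induction k)
  case 0
  have "primeideal (P n) poly_ring" using chain by (simp add: prime_chain_def)
  \<comment> \<open>The start is \<open>{1}\<close>: a multiple of 1 by a nonzero constant lies in
    no prime.\<close>
  then have "lin_indep_mod (P n) (\<lambda>u. u) {1}"
    using single_unit_in_ideal[of "P n" _ 1] prime_ideal prime_one
    by (auto simp: lin_indep_mod_def)
  then show ?case by (intro exI[of _ "{1}"]) (simp add: exps_le_one)
next
  case (Suc k)
  then obtain U where U: "finite U" "card U = N ^ k" "U \<subseteq> exps_le (k * (N * e))"
      "lin_indep_mod (P (n - k)) (\<lambda>u. u) U" by auto
  define i where "i = n - Suc k"
  have i: "Suc i = n - k" "i < n" using Suc.prems by (auto simp: i_def)
  let ?u = "\<lambda>(j, a). x i ^ j * a" and ?A = "{..<N} \<times> U"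
  have P: "primeideal (P i) poly_ring" "ideal (P (Suc i)) poly_ring" "P i \<subseteq> P (Suc i)"
    using chain i(2) by (auto simp: prime_chain_def intro: prime_ideal)
  have fin: "finite ?A" using U(1) by simp
  have indep: "lin_indep_mod (P i) ?u ?A"
    using x(1)[OF i(2)] U by (intro lin_indep_mod_step[OF P]) (auto simp: i(1))
  have "card (?u ` ?A) = N ^ Suc k"
    using card_image[OF lin_indep_mod_inj[OF prime_ideal[OF P(1)] fin indep]] U(2)
    by (simp add: card_cartesian_product)
  moreover have "?u ` ?A \<subseteq> exps_le (Suc k * (N * e))"
  proof clarify
    fix j a assume ja: "j < N" "a \<in> U"
    have "x i ^ j \<in> exps_le (N * e)"
      using exps_le_power[OF x(2)[OF i(2)], of j] ja(1) exps_le_mono[of "j * e" "N * e"] by simp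
    then show "x i ^ j * a \<in> exps_le (Suc k * (N * e))"
      using exps_le_mult[of "x i ^ j" "N * e" a "k * (N * e)"] ja U(3) by auto
  qed
  ultimately show ?case
    using lin_indep_mod_image[OF prime_ideal[OF P(1)] fin indep] fin
    by (intro exI[of _ "?u ` ?A"]) (simp add: i_def)
qed

text \<open>A growth comparison: a chain of length \<open>s + 1\<close> yields
  \<open>N ^ (s + 1)\<close> independent elements inside a space whose dimension is only of order
  \<open>N ^ s\<close>.\<close>

lemma prime_chain_length_le:
  fixes P :: "nat \<Rightarrow> ('n::finite, 'k::field) mpoly set"
  assumes "prime_chain poly_ring P n"
  shows "n \<le> card (UNIV :: 'n set)"
proof (rule ccontr)
  define s where "s = card (UNIV :: 'n set)"
  assume "\<not> n \<le> card (UNIV :: 'n set)"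
  then have chain: "prime_chain poly_ring P (Suc s)"
    using assms by (auto simp: prime_chain_def s_def)
  then have "\<forall>i<Suc s. \<exists>y. y \<in> P (Suc i) - P i"
    by (auto simp: prime_chain_def)
  then obtain x where x: "\<And>i. i < Suc s \<Longrightarrow> x i \<in> P (Suc i) - P i" by metis
  obtain e where e: "x ` {..<Suc s} \<subseteq> exps_le e"
    using finite_subset_exps_le[of "x ` {..<Suc s}"] by auto
  \<comment> \<open>\<open>B\<close> does not depend on \<open>N\<close> and satisfies
    \<open>1 + (s + 1) * N * e \<le> N * B\<close> for \<open>N \<ge> 1\<close>; \<open>N\<close> is
    then taken larger than \<open>B ^ s\<close>.\<close>
  define B where "B = Suc (Suc s * e)"
  define N where "N = Suc (B ^ s)"
  obtain U where U: "finite U" "card U = N ^ Suc s" "U \<subseteq> exps_le (Suc s * (N * e))"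
      "lin_indep_mod (P (Suc s - Suc s)) (\<lambda>u. u) U"
    using prime_chain_indep[OF chain x, of e "Suc s" N] e by auto
  have "ideal (P (Suc s - Suc s)) poly_ring"
    using chain by (auto simp: prime_chain_def intro: prime_ideal)
  from card_lin_indep_mod_le[OF this U(1,3,4)] U(2)
  have "N ^ Suc s \<le> Suc (Suc s * (N * e)) ^ s" by (simp add: s_def)
  also have "\<dots> \<le> (N * B) ^ s"
    by (intro power_mono) (auto simp: N_def B_def algebra_simps)
  finally have "N ^ s * N \<le> N ^ s * B ^ s"
    by (simp add: power_mult_distrib mult.commute)
  then have "N \<le> B ^ s" by (simp add: N_def)
  then show False by (simp add: N_def)
qed

text \<open>Append \<open>q\<close> to a longest chain ending in \<open>p\<close>. A longest chain
  exists because chain lengths are bounded by the number of variables.\<close>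

lemma prime_height_strict_mono:
  fixes p q :: "('n::finite, 'k::field) mpoly set"
  assumes p: "primeideal p poly_ring" and q: "primeideal q poly_ring" and "p \<subset> q"
  shows "prime_height poly_ring p < prime_height poly_ring q"
proof -
  define A where "A = {n. \<exists>P. prime_chain poly_ring P n \<and> P n = p}"
  have "finite A"
    using prime_chain_length_le by (intro finite_subset[of A "{..card (UNIV :: 'n set)}"]) (auto simp: A_def)
  moreover have "0 \<in> A"
    using p by (auto simp: A_def prime_chain_def intro!: exI[of _ "\<lambda>_. p"])
  ultimately have M: "Max A \<in> A" "\<And>n. n \<in> A \<Longrightarrow> n \<le> Max A"
    by (auto intro: Max_in Max_ge)
  then obtain P where P: "prime_chain poly_ring P (Max A)" "P (Max A) = p" by (auto simp: A_def)
  have "prime_chain poly_ring (P(Suc (Max A) := q)) (Suc (Max A))"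
    using P q assms(3) by (auto simp: prime_chain_def less_Suc_eq le_Suc_eq)
  then have "enat (Suc (Max A)) \<le> prime_height poly_ring q"
    unfolding prime_height_def
    by (intro Sup_upper) (auto intro!: exI[of _ "P(Suc (Max A) := q)"])
  moreover have "prime_height poly_ring p \<le> enat (Max A)"
    unfolding prime_height_def 
  proof (rule Sup_least)
    fix h assume "h \<in> {enat n |n. \<exists>P. prime_chain poly_ring P n \<and> P n = p}"
    then obtain n where "h = enat n" "n \<in> A" by (auto simp: A_def)
    then show "h \<le> enat (Max A)" using M(2) by simp
  qed
  ultimately show ?thesis
    by (metis enat_ord_simps(2) lessI order_le_less_trans order_less_le_trans)
qed

section \<open>The graded part of a prime ideal\<close>

lemma lookup_form_component:
  "Poly_Mapping.lookup (form_component d p) m = (if mdeg m = d then Poly_Mapping.lookup p m else 0)"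
proof -
  let ?A = "{m \<in> Poly_Mapping.keys p. mdeg m = d}"
  have "Poly_Mapping.lookup (form_component d p) m
      = (\<Sum>m'\<in>?A. if m' = m then Poly_Mapping.lookup p m else 0)"
    unfolding form_component_def lookup_sum
    by (intro sum.cong) (auto simp: lookup_single)
  also have "\<dots> = (if m \<in> ?A then Poly_Mapping.lookup p m else 0)"
    by (simp add: sum.delta')
  also have "\<dots> = (if mdeg m = d then Poly_Mapping.lookup p m else 0)"
    by (auto simp: in_keys_iff)
  finally show ?thesis .
qed

lemma mdeg_add: "mdeg (a + b) = mdeg a + mdeg b"
  by (simp add: mdeg_def lookup_add sum.distrib)

lemma forms_mult: "p \<in> forms a \<Longrightarrow> q \<in> forms b \<Longrightarrow> p * q \<in> forms (a + b)"
  using keys_mult[of p q] by (fastforce simp: forms_def mdeg_add)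

lemma form_component_in_forms: "form_component d p \<in> forms d"
  by (auto simp: forms_def in_keys_iff lookup_form_component split: if_splits)

lemma form_component_form:
  assumes "p \<in> forms d"
  shows "form_component e p = (if e = d then p else 0)"
proof (rule poly_mapping_eqI)
  fix m
  have "Poly_Mapping.lookup p m = 0" if "mdeg m \<noteq> d"
    using assms that by (auto simp: forms_def in_keys_iff)
  then show "Poly_Mapping.lookup (form_component e p) m
      = Poly_Mapping.lookup (if e = d then p else 0) m"
    by (auto simp: lookup_form_component)
qed

lemma form_component_zero [simp]: "form_component d 0 = 0"
  by (rule poly_mapping_eqI) (simp add: lookup_form_component)

lemma form_component_add: "form_component d (p + q) = form_component d p + form_component d q"
  by (rule poly_mapping_eqI) (simp add: lookup_form_component lookup_add)

lemma form_component_sum: "form_component d (sum f A) = (\<Sum>a\<in>A. form_component d (f a))"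
  by (induction A rule: infinite_finite_induct) (simp_all add: form_component_add)

lemma sum_form_components:
  "(\<Sum>d\<in>mdeg ` Poly_Mapping.keys p. form_component d p) = p"
proof (rule poly_mapping_eqI)
  fix m
  show "Poly_Mapping.lookup (\<Sum>d\<in>mdeg ` Poly_Mapping.keys p. form_component d p) m
      = Poly_Mapping.lookup p m"
    by (auto simp: lookup_sum lookup_form_component in_keys_iff)
qed

lemma form_component_nonzero:
  "form_component d p \<noteq> 0 \<Longrightarrow> d \<in> mdeg ` Poly_Mapping.keys p"
  using lookup_form_component[of d p]
  by (metis (no_types, lifting) image_eqI in_keys_iff poly_mapping_eqI lookup_zero)

text \<open>Multiply out the decompositions of \<open>p\<close> and \<open>q\<close>: a product of
  forms of degrees \<open>i\<close> and \<open>j\<close> is a form of degree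
  \<open>i + j\<close>.\<close>

lemma form_component_mult:
  fixes p q :: "('n::finite, 'k::field) mpoly"
  defines "A \<equiv> mdeg ` Poly_Mapping.keys p" and "B \<equiv> mdeg ` Poly_Mapping.keys q"
  shows "form_component d (p * q)
    = (\<Sum>(i, j)\<in>A \<times> B. if i + j = d then form_component i p * form_component j q else 0)"
proof -
  have "p * q = (\<Sum>i\<in>A. form_component i p) * (\<Sum>j\<in>B. form_component j q)"
    by (simp add: A_def B_def sum_form_components)
  also have "\<dots> = (\<Sum>(i, j)\<in>A \<times> B. form_component i p * form_component j q)"
    by (simp add: sum_product sum.cartesian_product)
  finally have "form_component d (p * q)
      = (\<Sum>x\<in>A \<times> B. form_component d (case x of (i, j) \<Rightarrow> form_component i p * form_component j q))"
    by (simp add: form_component_sum)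
  also have "\<dots> = (\<Sum>(i, j)\<in>A \<times> B. if i + j = d then form_component i p * form_component j q else 0)"
    by (intro sum.cong refl)
      (auto simp: form_component_form[OF forms_mult[OF form_component_in_forms form_component_in_forms]])
  finally show ?thesis .
qed

text \<open>For an ideal \<open>P\<close> this is the largest graded ideal contained in
  \<open>P\<close>.\<close>

definition graded_part :: "('n::finite, 'k::field) mpoly set \<Rightarrow> ('n, 'k) mpoly set" where
  "graded_part P = {p. \<forall>d. form_component d p \<in> P}"

lemma ideal_graded_part:
  fixes P :: "('n::finite, 'k::field) mpoly set"
  assumes "ideal P poly_ring"
  shows "ideal (graded_part P) poly_ring"
  unfolding ideal_poly_ring_iff
proof (intro conjI ballI allI)
  show "0 \<in> graded_part P" using ideal_zero[OF assms] by (simp add: graded_part_def)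
  show "a + b \<in> graded_part P" if "a \<in> graded_part P" "b \<in> graded_part P" for a b
    using that ideal_add[OF assms] by (simp add: graded_part_def form_component_add)
  show "r * a \<in> graded_part P" if "a \<in> graded_part P" for a r
  proof -
    have "form_component d (r * a) \<in> P" for d
      unfolding form_component_mult using that
      by (intro ideal_sum[OF assms])
        (auto simp: graded_part_def ideal_mult[OF assms] ideal_zero[OF assms])
    then show ?thesis by (simp add: graded_part_def)
  qed
qed

lemma graded_part_subset:
  fixes P :: "('n::finite, 'k::field) mpoly set"
  assumes "ideal P poly_ring"
  shows "graded_part P \<subseteq> P"
proof
  fix p assume "p \<in> graded_part P"
  then have "(\<Sum>d\<in>mdeg ` Poly_Mapping.keys p. form_component d p) \<in> P"
    by (intro ideal_sum[OF assms]) (simp add: graded_part_def)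
  then show "p \<in> P" by (simp only: sum_form_components)
qed

text \<open>If \<open>a\<close> and \<open>b\<close> are the highest degrees in which the components of \<open>p\<close> and \<open>q\<close> lie outside
  \<open>P\<close>, then the component of \<open>p q\<close> in degree \<open>a + b\<close> is, modulo \<open>P\<close>, a product of two elements
  outside \<open>P\<close>.\<close>

lemma primeideal_graded_part:
  fixes P :: "('n::finite, 'k::field) mpoly set"
  assumes P: "primeideal P poly_ring"
  shows "primeideal (graded_part P) poly_ring"
  unfolding primeideal_poly_ring_iff
proof (intro conjI allI impI)
  note I = prime_ideal[OF P]
  show "ideal (graded_part P) poly_ring" by (rule ideal_graded_part[OF I])
  show "1 \<notin> graded_part P" using graded_part_subset[OF I] prime_one[OF P] by blast
  show "p \<in> graded_part P \<or> q \<in> graded_part P" if pq: "p * q \<in> graded_part P" for p q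
  proof (rule ccontr)
    have top: "\<exists>a. form_component a f \<notin> P \<and> (\<forall>i>a. form_component i f \<in> P)"
      if "f \<notin> graded_part P" for f
    proof -
      let ?D = "{d. form_component d f \<notin> P}"
      have "?D \<subseteq> mdeg ` Poly_Mapping.keys f"
        using ideal_zero[OF I] by (auto intro!: form_component_nonzero)
      then have fin: "finite ?D" by (rule finite_subset) simp
      have "?D \<noteq> {}" using that by (auto simp: graded_part_def)
      with fin have "Max ?D \<in> ?D" by (rule Max_in)
      moreover have "i \<notin> ?D" if "i > Max ?D" for i
        using Max_ge[OF fin, of i] that by auto
      ultimately show ?thesis by blast
    qed
    assume "\<not> ?thesis"
    then obtain a b where a: "form_component a p \<notin> P" "\<And>i. i > a \<Longrightarrow> form_component i p \<in> P"
      and b: "form_component b q \<notin> P" "\<And>j. j > b \<Longrightarrow> form_component j q \<in> P"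
      using top by meson
    let ?K = "mdeg ` Poly_Mapping.keys p \<times> mdeg ` Poly_Mapping.keys q"
    let ?t = "\<lambda>(i, j). if i + j = a + b then form_component i p * form_component j q else 0"
    have "a \<in> mdeg ` Poly_Mapping.keys p" "b \<in> mdeg ` Poly_Mapping.keys q"
      using a(1) b(1) ideal_zero[OF I] by (metis form_component_nonzero)+
    then have "sum ?t ?K = ?t (a, b) + sum ?t (?K - {(a, b)})"
      by (intro sum.remove) auto
    moreover have "sum ?t ?K \<in> P"
      using pq by (simp add: graded_part_def flip: form_component_mult)
    moreover have "sum ?t (?K - {(a, b)}) \<in> P"
    proof (rule ideal_sum[OF I])
      fix x assume x: "x \<in> ?K - {(a, b)}"
      obtain i j where ij: "x = (i, j)" by (cases x)
      \<comment> \<open>If \<open>i + j = a + b\<close> but \<open>(i, j)\<close> differs from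
        \<open>(a, b)\<close>, one index exceeds its maximum, and that factor lies in
        \<open>P\<close>.\<close>
      consider "i + j \<noteq> a + b" | "i > a" | "j > b" using x ij by force
      then show "?t x \<in> P"
        by cases (auto simp: ij a(2) b(2) ideal_zero[OF I] ideal_mult[OF I] ideal_mult'[OF I])
    qed
    ultimately have "?t (a, b) \<in> P"
      using ideal_diff[OF I, of "sum ?t ?K" "sum ?t (?K - {(a, b)})"] by simp
    then show False using prime_multD[OF P] a(1) b(1) by simp blast
  qed
qed

section \<open>The irrelevant ideal as an associated prime\<close>

definition irrelevant_ideal :: "('n::finite, 'k::field) mpoly set" where
  "irrelevant_ideal = {p. Poly_Mapping.lookup p 0 = 0}"

lemma diff_constant_in_irrelevant_ideal:
  "p - Poly_Mapping.single 0 (Poly_Mapping.lookup p 0) \<in> irrelevant_ideal"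
  by (simp add: irrelevant_ideal_def lookup_minus)

lemma mdeg_zero_iff: "mdeg m = 0 \<longleftrightarrow> m = 0"
  by (auto simp: mdeg_def intro: poly_mapping_eqI)

text \<open>The constant term is the component of degree 0, so it lies in \<open>P\<close>; if
  nonzero, it would be a unit.\<close>

lemma graded_part_subset_irrelevant_ideal:
  fixes P :: "('n::finite, 'k::field) mpoly set"
  assumes P: "primeideal P poly_ring"
  shows "graded_part P \<subseteq> irrelevant_ideal"
proof
  fix p assume "p \<in> graded_part P"
  then have "form_component 0 p \<in> P" by (simp add: graded_part_def)
  moreover have "form_component 0 p = Poly_Mapping.single 0 (Poly_Mapping.lookup p 0)"
    by (rule poly_mapping_eqI) (auto simp: lookup_form_component mdeg_zero_iff lookup_single when_def)
  ultimately show "p \<in> irrelevant_ideal"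
    using single_unit_in_ideal[OF prime_ideal[OF P], of "Poly_Mapping.lookup p 0" 1] prime_one[OF P]
    by (auto simp: irrelevant_ideal_def)
qed

text \<open>Maximality of the irrelevant ideal: subtract from an element with nonzero constant term
  its part without constant term.\<close>

lemma irrelevant_ideal_proper_superset:
  fixes J :: "('n::finite, 'k::field) mpoly set"
  assumes J: "ideal J poly_ring" and "irrelevant_ideal \<subset> J"
  shows "1 \<in> J"
proof -
  obtain p where p: "p \<in> J" "Poly_Mapping.lookup p 0 \<noteq> 0"
    using assms(2) by (auto simp: irrelevant_ideal_def)
  have "p - Poly_Mapping.single 0 (Poly_Mapping.lookup p 0) \<in> J"
    using diff_constant_in_irrelevant_ideal[of p] assms(2) by blast
  from ideal_diff[OF J p(1) this] show ?thesis
    using single_unit_in_ideal[OF J, of "Poly_Mapping.lookup p 0" 1] p(2) by simp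
qed

text \<open>Modulo the irrelevant ideal, \<open>b\<close> equals its constant term, which is a unit
  if \<open>b\<close> lies outside. The ideal property is supplied where the irrelevant ideal is
  identified with some \<open>(I : y)\<close>.\<close>

lemma primeideal_irrelevant_ideal:
  assumes I: "ideal (irrelevant_ideal :: ('n::finite, 'k::field) mpoly set) poly_ring"
  shows "primeideal (irrelevant_ideal :: ('n, 'k) mpoly set) poly_ring"
  unfolding primeideal_poly_ring_iff
proof (intro conjI allI impI)
  let ?m = "irrelevant_ideal :: ('n, 'k) mpoly set"
  show "ideal ?m poly_ring" by fact
  show "1 \<notin> ?m" by (simp add: irrelevant_ideal_def lookup_one)
  show "a \<in> ?m \<or> b \<in> ?m" if ab: "a * b \<in> ?m" for a b :: "('n, 'k) mpoly"
  proof (rule disjCI)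
    assume b: "b \<notin> ?m"
    let ?c = "Poly_Mapping.lookup b 0"
    have "a * b - a * (b - Poly_Mapping.single 0 ?c) \<in> ?m"
      by (intro ideal_diff[OF I] ab ideal_mult[OF I] diff_constant_in_irrelevant_ideal)
    then have "Poly_Mapping.single 0 ?c * a \<in> ?m" by (simp add: algebra_simps)
    then show "a \<in> ?m"
      using single_unit_in_ideal[OF I] b by (auto simp: irrelevant_ideal_def)
  qed
qed

text \<open>Lower the degree: either the forms of degree \<open>d\<close> already send
  \<open>x\<close> into \<open>I\<close>, or some \<open>g * x\<close> with \<open>g\<close> of
  degree \<open>d\<close> lies outside \<open>I\<close> and is sent into \<open>I\<close> by all
  linear forms.\<close>

lemma linear_forms_annihilate:
  fixes I :: "('n::finite, 'k::field) mpoly set"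
  assumes "x \<notin> I" "\<And>g. g \<in> forms d \<Longrightarrow> g * x \<in> I"
  shows "\<exists>y. y \<notin> I \<and> (\<forall>g\<in>forms 1. g * y \<in> I)"
  using assms
proof (induction d)
  case 0
  have "1 \<in> forms 0" by (simp add: forms_def mdeg_zero_iff)
  with 0 show ?case by force
next
  case (Suc d)
  show ?case
  proof (cases "\<forall>g\<in>forms d. g * x \<in> I")
    case True
    with Suc show ?thesis by blast
  next
    case False
    then obtain g where g: "g \<in> forms d" "g * x \<notin> I" by blast
    have "h * (g * x) \<in> I" if "h \<in> forms 1" for h
      using Suc.prems(2)[of "h * g"] forms_mult[OF that g(1)] by (simp add: mult.assoc)
    with g show ?thesis by blast
  qed
qed

text \<open>If all linear forms send \<open>y\<close> into \<open>I\<close>, then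
  \<open>(I : y)\<close> contains every polynomial without constant term. It does not contain 1, so
  it equals the irrelevant ideal by maximality.\<close>

lemma irrelevant_ideal_associated:
  fixes I :: "('n::finite, 'k::field) mpoly set"
  assumes I: "ideal I poly_ring" and x: "x \<notin> I" "\<And>g. g \<in> forms d \<Longrightarrow> g * x \<in> I"
  shows "irrelevant_ideal \<in> associated_primes poly_ring I"
proof -
  obtain y where y: "y \<notin> I" "\<And>g. g \<in> forms 1 \<Longrightarrow> g * y \<in> I"
    using linear_forms_annihilate[of x I d] x by blast
  have Q: "ideal (ideal_quotient poly_ring I {y}) poly_ring"
    by (rule ideal_ideal_quotient_singleton[OF I])
  have sub: "irrelevant_ideal \<subseteq> ideal_quotient poly_ring I {y}"
  proof
    fix p :: "('n, 'k) mpoly" assume p: "p \<in> irrelevant_ideal"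
    have "Poly_Mapping.single m c * y \<in> I" if m: "m \<in> Poly_Mapping.keys p" for m c
    proof -
      have "m \<noteq> 0" using p m by (auto simp: irrelevant_ideal_def in_keys_iff)
      then obtain i where i: "Poly_Mapping.lookup m i \<noteq> 0"
        by (metis lookup_zero poly_mapping_eqI)
      let ?e = "Poly_Mapping.single i (1::nat)"
      \<comment> \<open>Split off one variable that occurs in the monomial; the truncated
        subtraction is exact there.\<close>
      have "(m - ?e) + ?e = m"
        using i by (intro poly_mapping_eqI) (auto simp: lookup_add lookup_minus lookup_single when_def)
      then have "Poly_Mapping.single m c = Poly_Mapping.single (m - ?e) c * Poly_Mapping.single ?e 1"
        by (simp add: mult_single)
      moreover have "mdeg ?e = 1" by (simp add: mdeg_def lookup_single when_def)
      then have "Poly_Mapping.single ?e 1 \<in> forms 1" by (simp add: forms_def)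
      from ideal_mult[OF I y(2)[OF this], of "Poly_Mapping.single (m - ?e) c"]
      have "Poly_Mapping.single (m - ?e) c * Poly_Mapping.single ?e 1 * y \<in> I"
        by (simp only: mult.assoc)
      ultimately show ?thesis by simp
    qed
    then have "(\<Sum>m\<in>Poly_Mapping.keys p. Poly_Mapping.single m (Poly_Mapping.lookup p m))
        \<in> ideal_quotient poly_ring I {y}"
      by (intro ideal_sum[OF Q]) (simp add: ideal_quotient_singleton)
    then show "p \<in> ideal_quotient poly_ring I {y}"
      using mpoly_eq_sum_single[of "Poly_Mapping.keys p" p] by simp
  qed
  have "1 \<notin> ideal_quotient poly_ring I {y}" using y(1) by (simp add: ideal_quotient_singleton)
  with irrelevant_ideal_proper_superset[OF Q] sub
  have eq: "irrelevant_ideal = ideal_quotient poly_ring I {y}" by blast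
  with primeideal_irrelevant_ideal Q show ?thesis
    by (auto simp: associated_primes_def)
qed

section \<open>Bases of a graded component of the quotient\<close>

lemma subalgebra_poly_ringI:
  fixes V :: "('n::finite, 'k::field) mpoly set"
  assumes "0 \<in> V" "\<And>a b. a \<in> V \<Longrightarrow> b \<in> V \<Longrightarrow> a + b \<in> V"
    and smult: "\<And>c a. a \<in> V \<Longrightarrow> Poly_Mapping.single 0 c * a \<in> V"
  shows "subalgebra (range (Poly_Mapping.single 0)) V poly_ring"
proof (rule subalgebra.intro)
  interpret R: cring "poly_ring :: ('n, 'k) mpoly ring" by (rule cring_poly_ring)
  show "subgroup V (add_monoid poly_ring)"
  proof (rule R.add.subgroupI)
    show "\<ominus>\<^bsub>poly_ring\<^esub> a \<in> V" if "a \<in> V" for a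
    proof -
      have "\<ominus>\<^bsub>poly_ring\<^esub> a = - a" by (rule R.minus_equality) simp_all
      also have "\<dots> = Poly_Mapping.single 0 (- 1) * a" by (simp add: single_uminus)
      finally show ?thesis using smult[OF that] by simp
    qed
  qed (use assms in auto)
  show "subalgebra_axioms (range (Poly_Mapping.single 0)) V poly_ring"
    using smult by (auto simp: subalgebra_axioms_def)
qed

lemma finite_monomials_of_degree:
  "finite {m :: 'n::finite \<Rightarrow>\<^sub>0 nat. mdeg m = d}"
proof (rule finite_subset)
  show "{m :: 'n \<Rightarrow>\<^sub>0 nat. mdeg m = d} \<subseteq> {m. \<forall>i. Poly_Mapping.lookup m i \<le> d}"
    by (auto simp: mdeg_def intro: member_le_sum)
qed (use card_bounded_exponents in blast)

text \<open>The classes of the finitely many monomials of degree \<open>d\<close> span. This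
  guarantees that \<open>hilbert_fun I d\<close> really is the dimension of the component.\<close>

lemma finite_dimension_graded_component:
  fixes I :: "('n::finite, 'k::field) mpoly set"
  assumes I: "ideal I poly_ring" "I \<noteq> UNIV"
  shows "ring.finite_dimension (poly_ring Quot I) (quot_scalars I) (residue_class I ` forms d)"
proof -
  let ?R = "poly_ring :: ('n, 'k) mpoly ring" and ?h = "residue_class I"
  let ?S = "?R Quot I" and ?K = "quot_scalars I"
  interpret R: cring ?R by (rule cring_poly_ring)
  interpret I: ideal I ?R by fact
  interpret h: ring_hom_ring ?R ?S ?h by (rule I.rcos_ring_hom_ring)
  have K: "subfield ?K ?S" by (rule quot_scalars_subfield[OF I])
  obtain ms :: "('n \<Rightarrow>\<^sub>0 nat) list" where ms: "set ms = {m. mdeg m = d}"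
    using finite_list[OF finite_monomials_of_degree] by blast
  let ?B = "map (\<lambda>m. ?h (Poly_Mapping.single m 1)) ms"
  have B: "set ?B \<subseteq> ?h ` forms d"
    using ms by (auto simp: forms_def)
  have carrier: "?h ` forms d \<subseteq> carrier ?S" using h.hom_closed by auto
  have "subalgebra (?h ` range (Poly_Mapping.single 0)) (?h ` forms d) ?S"
  proof (intro h.img_is_subalgebra subalgebra_poly_ringI)
    show "a + b \<in> forms d" if "a \<in> forms d" "b \<in> forms d" for a b :: "('n, 'k) mpoly"
      using that keys_add[of a b] by (auto simp: forms_def)
    show "Poly_Mapping.single 0 c * a \<in> forms d" if "a \<in> forms d" for c and a :: "('n, 'k) mpoly"
      using forms_mult[of "Poly_Mapping.single 0 c" 0 a d] that
      by (simp add: forms_def mdeg_zero_iff)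
  qed (auto simp: forms_def)
  then have "h.S.Span ?K ?B \<subseteq> ?h ` forms d"
    using B by (intro h.S.subalgebra_Span_incl[OF K]) (simp_all add: quot_scalars_def)
  moreover have "?h ` forms d \<subseteq> h.S.Span ?K ?B"
  proof clarify
    fix g :: "('n, 'k) mpoly" assume g: "g \<in> forms d"
    have sum: "?h (sum f A) \<in> h.S.Span ?K ?B"
      if "\<And>m. m \<in> A \<Longrightarrow> ?h (f m) \<in> h.S.Span ?K ?B" for f and A :: "('n \<Rightarrow>\<^sub>0 nat) set"
      using that
    proof (induction A rule: infinite_finite_induct)
      case (insert m A)
      have "?h (f m + sum f A) = ?h (f m) \<oplus>\<^bsub>?S\<^esub> ?h (sum f A)"
        using h.hom_add[of "f m" "sum f A"] by simp
      with insert show ?case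
        using h.S.Span_subgroup_props(3)[OF K] B carrier by auto
    qed (use h.hom_zero h.S.Span_subgroup_props(2)[OF K] B carrier in auto)
    have "?h (Poly_Mapping.single m c) \<in> h.S.Span ?K ?B" if "m \<in> Poly_Mapping.keys g" for m c
    proof -
      have "?h (Poly_Mapping.single m 1) \<in> set ?B"
        using that g ms by (auto simp: forms_def)
      then have "?h (Poly_Mapping.single m 1) \<in> h.S.Span ?K ?B"
        using h.S.Span_base_incl[OF K] B carrier by blast
      moreover have "?h (Poly_Mapping.single 0 c) \<in> ?K" by (auto simp: quot_scalars_def)
      ultimately have "?h (Poly_Mapping.single 0 c) \<otimes>\<^bsub>?S\<^esub> ?h (Poly_Mapping.single m 1) \<in> h.S.Span ?K ?B"
        using h.S.Span_smult_closed[OF K] B carrier by blast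
      then show ?thesis
        using h.hom_mult[of "Poly_Mapping.single 0 c" "Poly_Mapping.single m 1"] by (simp add: mult_single)
    qed
    then have "?h (\<Sum>m\<in>Poly_Mapping.keys g. Poly_Mapping.single m (Poly_Mapping.lookup g m))
        \<in> h.S.Span ?K ?B"
      by (intro sum)
    then show "?h g \<in> h.S.Span ?K ?B"
      using mpoly_eq_sum_single[of "Poly_Mapping.keys g" g] by simp
  qed
  ultimately have "?h ` forms d = h.S.Span ?K ?B" by blast
  then show ?thesis
    using h.S.Span_finite_dimension[OF K, of ?B] B carrier by simp
qed

text \<open>As many independent classes as the dimension form a basis of the component, so an
  \<open>x\<close> sent into \<open>I\<close> by the chosen forms is sent into \<open>I\<close> by
  all forms of degree \<open>d\<close>.\<close>

lemma gmd_family_hilbert_fun_annihilates: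
  fixes I :: "('n::finite, 'k::field) mpoly set"
  assumes I: "ideal I poly_ring" "I \<noteq> UNIV" and "F \<in> gmd_family I d (hilbert_fun I d)"
  shows "\<exists>x. x \<notin> I \<and> (\<forall>g\<in>forms d. g * x \<in> I)"
proof -
  let ?R = "poly_ring :: ('n, 'k) mpoly ring" and ?h = "residue_class I"
  let ?S = "?R Quot I" and ?K = "quot_scalars I"
  interpret R: cring ?R by (rule cring_poly_ring)
  interpret I: ideal I ?R by fact
  interpret h: ring_hom_ring ?R ?S ?h by (rule I.rcos_ring_hom_ring)
  have K: "subfield ?K ?S" by (rule quot_scalars_subfield[OF I])
  obtain fs where fs: "length fs = hilbert_fun I d" "set fs \<subseteq> forms d"
      "h.S.independent ?K (map ?h fs)" "ideal_quotient ?R I (genideal ?R (set fs)) \<noteq> I"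
    using assms(3) by (auto simp: gmd_family_def)
  have "I \<subseteq> ideal_quotient ?R I (genideal ?R (set fs))"
    using ideal_mult'[OF I(1)] by (auto simp: ideal_quotient_def)
  with fs(4) obtain x where x: "x \<notin> I" "x \<in> ideal_quotient ?R I (genideal ?R (set fs))" by blast
  then have fx: "f * x \<in> I" if "f \<in> set fs" for f
    using that R.genideal_self[of "set fs"] by (auto simp: ideal_quotient_def mult.commute)
  have "h.S.dimension (hilbert_fun I d) ?K (?h ` forms d)"
    using h.S.finite_dimensionE[OF K finite_dimension_graded_component[OF I]]
    by (simp add: hilbert_fun_def quot_dim_def)
  then have span: "h.S.Span ?K (map ?h fs) = ?h ` forms d"
    using h.S.independent_length_eq_dimension[OF K _ fs(3)] fs(1,2)
    by (metis (no_types, lifting) image_mono length_map list.set_map)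
  let ?J = "ideal_quotient ?R I {x}"
  \<comment> \<open>The image of \<open>(I : x)\<close> is a subspace containing the basis, hence it
    contains the span.\<close>
  have "subalgebra ?K (?h ` ?J) ?S"
    unfolding quot_scalars_def
    by (intro h.img_is_subalgebra R.ideal_is_subalgebra ideal_ideal_quotient_singleton[OF I(1)]) auto
  then have "?h ` forms d \<subseteq> ?h ` ?J"
    unfolding span[symmetric]
    using fx by (intro h.S.subalgebra_Span_incl[OF K]) (auto simp: ideal_quotient_singleton)
  \<comment> \<open>\<open>g\<close> agrees modulo \<open>I\<close> with some \<open>g'\<close> in
    \<open>(I : x)\<close>, and the difference times \<open>x\<close> stays in
    \<open>I\<close>.\<close>
  have "g * x \<in> I" if "g \<in> forms d" for g
  proof -
    obtain g' where g': "?h g = ?h g'" "g' * x \<in> I"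
      using \<open>?h ` forms d \<subseteq> ?h ` ?J\<close> \<open>g \<in> forms d\<close> by (auto simp: ideal_quotient_singleton)
    have "g \<in> ?h g'" using I.a_rcos_self[of g] g'(1) by simp
    then obtain y where "y \<in> I" "g = y + g'" by (auto simp: a_r_coset_def')
    then show ?thesis
      using ideal_add[OF I(1) ideal_mult'[OF I(1)] g'(2)] by (simp add: distrib_right)
  qed
  with x(1) show ?thesis by blast
qed

section \<open>Primes of the quotient ring and the comparison of heights\<close>

lemma krull_dim_quot_primes:
  fixes I :: "('n::finite, 'k::field) mpoly set"
  assumes I: "ideal I poly_ring" and dim: "krull_dim (poly_ring Quot I) \<ge> 1"
  shows "\<exists>P Q. primeideal P poly_ring \<and> primeideal Q poly_ring \<and> I \<subseteq> P \<and> P \<subset> Q"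
proof -
  let ?R = "poly_ring :: ('n, 'k) mpoly ring" and ?h = "residue_class I"
  let ?S = "?R Quot I"
  interpret R: cring ?R by (rule cring_poly_ring)
  interpret I: ideal I ?R by fact
  interpret h: ring_hom_ring ?R ?S ?h by (rule I.rcos_ring_hom_ring)
  have "\<exists>n P. prime_chain ?S P n \<and> n \<noteq> 0"
  proof (rule ccontr)
    assume "\<not> ?thesis"
    then have "krull_dim ?S \<le> 0"
      unfolding krull_dim_def by (intro Sup_least) (auto simp: zero_enat_def)
    with dim show False by simp
  qed
  then obtain P n where "prime_chain ?S P n" "n \<noteq> 0" by blast
  then have P: "primeideal (P 0) ?S" "primeideal (P 1) ?S" "P 0 \<subset> P 1"
    by (auto simp: prime_chain_def)
  \<comment> \<open>The first two primes of a chain of positive length in the quotient are pulled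
    back along the residue map.\<close>
  let ?pre = "\<lambda>p. {r \<in> carrier ?R. ?h r \<in> p}"
  have "I \<subseteq> ?pre (P 0)"
  proof
    fix r assume "r \<in> I"
    then have "?h r = \<zero>\<^bsub>?S\<^esub>" using I.a_rcos_const by (simp add: FactRing_def)
    moreover have "\<zero>\<^bsub>?S\<^esub> \<in> P 0"
      using P(1) by (simp add: primeideal_def ideal_def additive_subgroup.zero_closed)
    ultimately show "r \<in> ?pre (P 0)" by simp
  qed
  \<comment> \<open>Strictness survives because the residue map is surjective.\<close>
  moreover have "?pre (P 0) \<subset> ?pre (P 1)"
  proof -
    obtain y where y: "y \<in> P 1" "y \<notin> P 0" using P(3) by blast
    have "y \<in> carrier ?S"
      using ideal.Icarr[OF primeideal.axioms(1)[OF P(2)] y(1)] .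
    then obtain r where "y = ?h r" by (auto simp: FactRing_def A_RCOSETS_def')
    with y P(3) show ?thesis by auto
  qed
  moreover have "primeideal (?pre (P i)) ?R" if "i \<le> 1" for i
    using h.primeideal_vimage[OF cring_poly_ring, of "P i"] P that by (cases i) auto
  ultimately show ?thesis by blast
qed

theorem proposition3p14:
  fixes I :: "('n::finite, 'k::field) mpoly set" and d :: nat
  assumes "I \<noteq> {0}"
    and "graded_ideal I"
    and "unmixed_ideal poly_ring I"
    and "krull_dim (poly_ring Quot I) \<ge> 1"
    and "d \<ge> 1"
  shows "gmd I d (hilbert_fun I d) = quot_degree I"
proof -
  let ?m = "irrelevant_ideal :: ('n, 'k) mpoly set"
  have I: "ideal I poly_ring" "I \<noteq> UNIV"
    using assms(3) by (auto simp: unmixed_ideal_def)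
  \<comment> \<open>For an empty family \<open>gmd\<close> takes its default value, the degree of
    the quotient.\<close>
  have "gmd_family I d (hilbert_fun I d) = {}"
  proof (rule ccontr)
    assume "gmd_family I d (hilbert_fun I d) \<noteq> {}"
    then obtain F where "F \<in> gmd_family I d (hilbert_fun I d)" by blast
    from gmd_family_hilbert_fun_annihilates[OF I this]
    have m: "?m \<in> associated_primes poly_ring I"
      using irrelevant_ideal_associated[OF I(1)] by blast
    obtain P Q where PQ: "primeideal P poly_ring" "primeideal Q poly_ring" "I \<subseteq> P" "P \<subset> Q"
      using krull_dim_quot_primes[OF I(1) assms(4)] by blast
    \<comment> \<open>Gradedness of \<open>I\<close> enters here: components of elements of
      \<open>I\<close> stay in \<open>I\<close>, hence in \<open>P\<close>.\<close>
    have "I \<subseteq> graded_part P"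
      using assms(2) PQ(3) by (auto simp: graded_ideal_def graded_part_def)
    then obtain q where q: "q \<in> associated_primes poly_ring I" "q \<subseteq> graded_part P"
      using associated_prime_below[OF I(1) primeideal_graded_part[OF PQ(1)]] by blast
    \<comment> \<open>Otherwise \<open>?m\<close> would be strictly below \<open>Q\<close>, and
      \<open>Q\<close> would contain 1.\<close>
    have "\<not> ?m \<subseteq> P"
      using irrelevant_ideal_proper_superset[OF prime_ideal[OF PQ(2)]] prime_one[OF PQ(2)] PQ(4)
      by blast
    then have "q \<subset> ?m"
      using q(2) graded_part_subset[OF prime_ideal[OF PQ(1)]]
        graded_part_subset_irrelevant_ideal[OF PQ(1)] by blast
    moreover have "primeideal q poly_ring" "primeideal ?m poly_ring"
      using q(1) m by (auto simp: associated_primes_def)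
    ultimately have "prime_height poly_ring q < prime_height poly_ring ?m"
      by (intro prime_height_strict_mono)
    moreover have "prime_height poly_ring q = prime_height poly_ring ?m"
      using assms(3) q(1) m unfolding unmixed_ideal_def by blast
    ultimately show False by simp
  qed
  then show ?thesis by (simp add: gmd_def)
qed

end
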